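(* Let $\mathcal{X}=(x_n)_{n=1}^\infty$ be a basis of a Banach space $\mathbb{X}$. Suppose that both $\mathcal{X}$ and its dual basis $\mathcal{X}^*=(x_n^* )_{n=1}^\infty$ are truncation quasi-greedy and partially democratic. Then $\mathcal{X}$ is bidemocratic.
   Context: The scalar field $\mathbb{F}$ is $\mathbb{R}$ or $\mathbb{C}$, and $\mathbb{X}$ is infinite-dimensional and separable. A basis of $\mathbb{X}$ is a norm-bounded sequence $(x_n)_{n=1}^\infty$ with $\overline{\operatorname{span}}(x_n\colon n\in\mathbb{N})=\mathbb{X}$ for which there is a (unique) norm-bounded sequence $\mathcal{X}^*=(x_n^* )_{n=1}^\infty$ in $\mathbb{X}^*$ with $x_n^*(x_k)=\delta_{n,k}$; $\mathcal{X}^*$ is called the dual basis. (No Schauder property is assumed.) Properties of $\mathcal{X}^*$ are understood by regarding $\mathcal{X}^*$ as a basis of its closed linear span in $\mathbb{X}^*$, the coefficients of $f^*$ being $(f^*(x_n))_{n=1}^\infty$. For finite $A\subseteq\mathbb{N}$ put $\mathbf{1}_A=\sum_{n\in A}x_n$. A finite set $A\subseteq\mathbb{N}$ is a greedy set of $f$ if $|x_n^*(f)|\ge|x_k^*(f)|$ whenever $n\in A$ and $k\notin A$. The basis is truncation quasi-greedy if there is a constant $\Lambda$ such that $\left\|\min_{n\in B}|x_n^*(f)|\sum_{n\in B}\operatorname{sign}(x_n^*(f))\,x_n\right\|\le\Lambda\|f\|$ for every $f\in\mathbb{X}$ and every greedy set $B$ of $f$ (here $\operatorname{sign}(z)=z/|z|$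 for $z\neq 0$). The basis is partially democratic if there is a constant $C$ such that for each finite $D\subseteq\mathbb{N}$ there is a finite $E$ with $D\subseteq E\subseteq\mathbb{N}$ such that $\|\mathbf{1}_A\|\le C\|\mathbf{1}_B\|$ whenever $A\subseteq D$ and $B\subseteq\mathbb{N}\setminus E$ (finite) satisfy $|A|\le|B|$. With $\varphi(m)=\sup_{|A|\le m}\|\sum_{k\in A}x_k\|$ and $\varphi^*(m)=\sup_{|A|\le m}\|\sum_{k\in A}x_k^*\|$, the basis is bidemocratic if there is a constant $\Delta_b$ with $\varphi(m)\varphi^*(m)\le\Delta_b\,m$ for all $m\in\mathbb{N}$. *)

theory Defs
  imports "HOL-Analysis.Analysis"
begin

text \<open>
  The libraries have no class of complex Banach spaces. A normed space over \<open>\<real>\<close> or \<open>\<complex>\<close>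
  is therefore a real normed space together with a compatible multiplication by scalars
  from \<open>'k\<close>; below, \<open>'k\<close> is always instantiated to \<open>real\<close> (with \<open>smul = scaleR\<close>) or to
  \<open>complex\<close>. Completeness is expressed by the sort \<open>banach\<close> of the underlying type.
\<close>

locale normed_space_over = vector_space smul
  for smul :: "'k::real_normed_field \<Rightarrow> 'a::real_normed_vector \<Rightarrow> 'a" +
  assumes smul_of_real: "smul (of_real r) v = r *\<^sub>R v"
    and norm_smul: "norm (smul c v) = norm c * norm v"

lemma normed_space_over_scaleR: "normed_space_over scaleR"
  by unfold_locales (auto simp: algebra_simps)

definition closed_span :: "('k::real_normed_field \<Rightarrow> 'a::real_normed_vector \<Rightarrow> 'a) \<Rightarrow> 'a set \<Rightarrow> 'a set"
  where "closed_span smul S = closure (module.span smul S)"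

text \<open>
  The dual space consists of those elements of \<open>'a \<Rightarrow>\<^sub>L 'k\<close> (bounded \<open>\<real>\<close>-linear maps with the
  operator norm) which are linear over \<open>'k\<close>.
\<close>

definition dual_space ::
    "('k::real_normed_field \<Rightarrow> 'a::real_normed_vector \<Rightarrow> 'a) \<Rightarrow> ('a \<Rightarrow>\<^sub>L 'k) set"
  where "dual_space smul =
    {f. \<forall>c v. blinfun_apply f (smul c v) = c * blinfun_apply f v}"

text \<open>Pointwise multiplication \<open>(c f) v = c * f v\<close>.\<close>

definition dual_smul ::
    "'k::real_normed_field \<Rightarrow> ('a::real_normed_vector \<Rightarrow>\<^sub>L 'k) \<Rightarrow> ('a \<Rightarrow>\<^sub>L 'k)"
  where "dual_smul c f = blinfun_mult_right c o\<^sub>L f"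

lemma dual_smul_apply [simp]: "blinfun_apply (dual_smul c f) v = c * blinfun_apply f v"
  by (simp add: dual_smul_def)

lemma normed_space_over_dual_smul:
  "normed_space_over
    (dual_smul :: 'k::real_normed_field \<Rightarrow> ('a::real_normed_vector \<Rightarrow>\<^sub>L 'k) \<Rightarrow> ('a \<Rightarrow>\<^sub>L 'k))"
proof unfold_locales
  show "norm (dual_smul c f) = norm c * norm f" for c :: 'k and f :: "'a \<Rightarrow>\<^sub>L 'k"
  proof (cases "c = 0")
    case True
    then have "dual_smul c f = 0" by (intro blinfun_eqI) simp
    with True show ?thesis by simp
  next
    case False
    have le: "norm (dual_smul d g) \<le> norm d * norm g" for d :: 'k and g :: "'a \<Rightarrow>\<^sub>L 'k"
      by (rule norm_blinfun_bound)
        (auto simp: norm_mult mult.assoc intro!: mult_left_mono norm_blinfun)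
    have "f = dual_smul (inverse c) (dual_smul c f)"
      using False by (intro blinfun_eqI) simp
    then have "norm f \<le> norm (inverse c) * norm (dual_smul c f)"
      using le by metis
    then have "norm c * norm f \<le> norm c * (norm (inverse c) * norm (dual_smul c f))"
      by (intro mult_left_mono) auto
    also have "\<dots> = norm (dual_smul c f)"
      using False by (simp flip: mult.assoc norm_mult)
    finally have "norm c * norm f \<le> norm (dual_smul c f)" .
    with le[of c f] show ?thesis by simp
  qed
qed (auto intro!: blinfun_eqI simp: blinfun.bilinear_simps algebra_simps scaleR_conv_of_real)

definition is_dual_sequence ::
    "('k::real_normed_field \<Rightarrow> 'a::real_normed_vector \<Rightarrow> 'a) \<Rightarrow> (nat \<Rightarrow> 'a) \<Rightarrow> (nat \<Rightarrow> 'a \<Rightarrow>\<^sub>L 'k) \<Rightarrow> bool"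
  where "is_dual_sequence smul x xs \<longleftrightarrow>
    range xs \<subseteq> dual_space smul \<and> bounded (range xs) \<and>
    (\<forall>n k. blinfun_apply (xs n) (x k) = (if n = k then 1 else 0))"

text \<open>
  A space with a basis in the following sense is automatically infinite-dimensional and separable.
\<close>

definition is_basis ::
    "('k::real_normed_field \<Rightarrow> 'a::real_normed_vector \<Rightarrow> 'a) \<Rightarrow> (nat \<Rightarrow> 'a) \<Rightarrow> bool"
  where "is_basis smul x \<longleftrightarrow>
    bounded (range x) \<and> closed_span smul (range x) = UNIV \<and> (\<exists>xs. is_dual_sequence smul x xs)"

definition dual_basis ::
    "('k::real_normed_field \<Rightarrow> 'a::real_normed_vector \<Rightarrow> 'a) \<Rightarrow> (nat \<Rightarrow> 'a) \<Rightarrow> nat \<Rightarrow> 'a \<Rightarrow>\<^sub>L 'k"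
  where "dual_basis smul x = (THE xs. is_dual_sequence smul x xs)"

lemma is_dual_sequence_unique:
  assumes "normed_space_over smul" "is_basis smul x"
    and xs: "is_dual_sequence smul x xs" and ys: "is_dual_sequence smul x ys"
  shows "xs = ys"
proof
  fix n
  interpret normed_space_over smul by fact
  let ?E = "{v. blinfun_apply (xs n) v = blinfun_apply (ys n) v}"
  have "xs n \<in> dual_space smul" "ys n \<in> dual_space smul"
    using xs ys by (auto simp: is_dual_sequence_def)
  then have "subspace ?E"
    by (auto simp: subspace_def dual_space_def blinfun.bilinear_simps)
  moreover have "range x \<subseteq> ?E"
    using xs ys by (auto simp: is_dual_sequence_def)
  ultimately have "span (range x) \<subseteq> ?E" by (rule span_minimal[rotated])
  moreover have "closed ?E"
    by (intro closed_Collect_eq continuous_intros)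
  ultimately have "closure (span (range x)) \<subseteq> ?E" by (rule closure_minimal)
  moreover have "closure (span (range x)) = UNIV"
    using assms(2) by (simp add: is_basis_def closed_span_def)
  ultimately show "xs n = ys n" by (intro blinfun_eqI) auto
qed

lemma is_dual_sequence_dual_basis:
  assumes "normed_space_over smul" "is_basis smul x"
  shows "is_dual_sequence smul x (dual_basis smul x)"
proof -
  from assms(2) obtain xs where xs: "is_dual_sequence smul x xs"
    by (auto simp: is_basis_def)
  show ?thesis
    unfolding dual_basis_def
    by (rule theI[of _ xs]) (use xs is_dual_sequence_unique[OF assms] in auto)
qed

text \<open>
  In the next two definitions \<open>c n f\<close> is the \<open>n\<close>-th coefficient of the vector \<open>f\<close>.
\<close>

definition greedy_set :: "(nat \<Rightarrow> 'a \<Rightarrow> 'k::real_normed_field) \<Rightarrow> 'a \<Rightarrow> nat set \<Rightarrow> bool"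
  where "greedy_set c f A \<longleftrightarrow>
    finite A \<and> (\<forall>n\<in>A. \<forall>k. k \<notin> A \<longrightarrow> norm (c n f) \<ge> norm (c k f))"

text \<open>
  Truncation quasi-greediness of the sequence \<open>x\<close> with coefficient functionals \<open>c\<close> on the
  subspace \<open>Y\<close>. In a normed field \<open>sgn z = z / norm z\<close> for \<open>z \<noteq> 0\<close>. The junk values
  \<open>sgn 0 = 0\<close> and \<open>Min {}\<close> are harmless, since the minimum is \<open>0\<close> in the first case and the
  sum is \<open>0\<close> in the second.
\<close>

definition truncation_quasi_greedy_on ::
    "('k::real_normed_field \<Rightarrow> 'a::real_normed_vector \<Rightarrow> 'a) \<Rightarrow> 'a set \<Rightarrow>
      (nat \<Rightarrow> 'a) \<Rightarrow> (nat \<Rightarrow> 'a \<Rightarrow> 'k) \<Rightarrow> bool"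
  where "truncation_quasi_greedy_on smul Y x c \<longleftrightarrow>
    (\<exists>\<Lambda>::real. \<forall>f\<in>Y. \<forall>B. greedy_set c f B \<longrightarrow>
      norm (Min ((\<lambda>n. norm (c n f)) ` B) *\<^sub>R (\<Sum>n\<in>B. smul (sgn (c n f)) (x n)))
        \<le> \<Lambda> * norm f)"

definition truncation_quasi_greedy ::
    "('k::real_normed_field \<Rightarrow> 'a::real_normed_vector \<Rightarrow> 'a) \<Rightarrow> (nat \<Rightarrow> 'a) \<Rightarrow> bool"
  where "truncation_quasi_greedy smul x \<longleftrightarrow>
    truncation_quasi_greedy_on smul UNIV x (\<lambda>n. blinfun_apply (dual_basis smul x n))"

text \<open>
  The dual basis as a basis of its closed linear span; the \<open>n\<close>-th coefficient of a functional
  \<open>f\<close> is \<open>f (x n)\<close>.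
\<close>

definition dual_truncation_quasi_greedy ::
    "('k::real_normed_field \<Rightarrow> 'a::real_normed_vector \<Rightarrow> 'a) \<Rightarrow> (nat \<Rightarrow> 'a) \<Rightarrow> bool"
  where "dual_truncation_quasi_greedy smul x \<longleftrightarrow>
    truncation_quasi_greedy_on dual_smul (closed_span dual_smul (range (dual_basis smul x)))
      (dual_basis smul x) (\<lambda>n f. blinfun_apply f (x n))"

definition partially_democratic :: "(nat \<Rightarrow> 'a::real_normed_vector) \<Rightarrow> bool"
  where "partially_democratic x \<longleftrightarrow>
    (\<exists>C::real. \<forall>D. finite D \<longrightarrow> (\<exists>E. finite E \<and> D \<subseteq> E \<and>
      (\<forall>A B. A \<subseteq> D \<longrightarrow> finite B \<longrightarrow> B \<subseteq> - E \<longrightarrow> card A \<le> card B \<longrightarrow>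
        norm (\<Sum>n\<in>A. x n) \<le> C * norm (\<Sum>n\<in>B. x n))))"

text \<open>
  The supremum is one of a nonempty set, bounded above whenever \<open>x\<close> is norm-bounded.
\<close>

definition upper_fundamental :: "(nat \<Rightarrow> 'a::real_normed_vector) \<Rightarrow> nat \<Rightarrow> real"
  where "upper_fundamental x m = (SUP A\<in>{A. finite A \<and> card A \<le> m}. norm (\<Sum>k\<in>A. x k))"

definition bidemocratic ::
    "('k::real_normed_field \<Rightarrow> 'a::real_normed_vector \<Rightarrow> 'a) \<Rightarrow> (nat \<Rightarrow> 'a) \<Rightarrow> bool"
  where "bidemocratic smul x \<longleftrightarrow>
    (\<exists>\<Delta>::real. \<forall>m. upper_fundamental x m * upper_fundamental (dual_basis smul x) m \<le> \<Delta> * real m)"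

end

theory Submission
  imports Defs
begin

text \<open>
  Let \<open>\<phi>\<close>, \<open>\<phi>\<^sup>*\<close> be the fundamental functions of \<open>x\<close> and of its dual basis. A vector of norm one
  that almost norms a sum of \<open>m\<close> dual vectors has its \<open>k\<close> largest coefficients contributing at
  most \<open>\<phi>\<^sup>*(k)\<close>, while truncation quasi-greediness bounds each of the others by \<open>C / \<phi>(k)\<close>. This
  gives \<open>\<phi>\<^sup>*(m) \<le> C (\<phi>\<^sup>*(k) + m / \<phi>(k))\<close>, and likewise with \<open>\<phi>\<close> and \<open>\<phi>\<^sup>*\<close> exchanged. Take \<open>k\<close> to be
  a small fixed fraction of \<open>m\<close>: if the second summand dominates in one of the inequalities, then
  \<open>\<phi>(m) \<phi>\<^sup>*(m) = O(m)\<close> directly; otherwise \<open>\<phi>(m) \<phi>\<^sup>*(m) \<le> C' \<phi>(k) \<phi>\<^sup>*(k)\<close>, and induction applies.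
\<close>

section \<open>Fundamental functions\<close>

lemma bdd_above_upper_fundamental:
  fixes x :: "nat \<Rightarrow> 'a::real_normed_vector"
  assumes "bounded (range x)"
  shows "bdd_above ((\<lambda>A. norm (\<Sum>k\<in>A. x k)) ` {A. finite A \<and> card A \<le> m})"
proof -
  obtain M where M: "M > 0" "\<And>n. norm (x n) \<le> M"
    using assms by (auto simp: bounded_pos)
  have "norm (\<Sum>k\<in>A. x k) \<le> real m * M" if "finite A" "card A \<le> m" for A
  proof -
    have "norm (\<Sum>k\<in>A. x k) \<le> real (card A) * M"
      using M by (intro sum_norm_bound) auto
    also have "\<dots> \<le> real m * M"
      using that M by (intro mult_right_mono) auto
    finally show ?thesis .
  qed
  then show ?thesis by (intro bdd_aboveI[where M = "real m * M"]) auto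
qed

lemma norm_sum_le_upper_fundamental:
  fixes x :: "nat \<Rightarrow> 'a::real_normed_vector"
  assumes "bounded (range x)" "finite A" "card A \<le> m"
  shows "norm (\<Sum>k\<in>A. x k) \<le> upper_fundamental x m"
  unfolding upper_fundamental_def
  using assms by (intro cSUP_upper bdd_above_upper_fundamental) auto

lemma upper_fundamental_le:
  fixes x :: "nat \<Rightarrow> 'a::real_normed_vector"
  assumes "\<And>A. finite A \<Longrightarrow> card A \<le> m \<Longrightarrow> norm (\<Sum>k\<in>A. x k) \<le> K"
  shows "upper_fundamental x m \<le> K"
  unfolding upper_fundamental_def
proof (rule cSUP_least)
  have "{} \<in> {A :: nat set. finite A \<and> card A \<le> m}" by simp
  then show "{A :: nat set. finite A \<and> card A \<le> m} \<noteq> {}" by blast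
qed (simp add: assms)

lemma upper_fundamental_nonneg:
  fixes x :: "nat \<Rightarrow> 'a::real_normed_vector"
  assumes "bounded (range x)"
  shows "0 \<le> upper_fundamental x m"
  using norm_sum_le_upper_fundamental[OF assms, of "{}" m] by simp

lemma upper_fundamental_mono:
  fixes x :: "nat \<Rightarrow> 'a::real_normed_vector"
  assumes "bounded (range x)" "k \<le> m"
  shows "upper_fundamental x k \<le> upper_fundamental x m"
  using assms by (intro upper_fundamental_le norm_sum_le_upper_fundamental) auto

text \<open>Split off \<open>k\<close> indices at a time and use the triangle inequality; the last
  block may be shorter. With \<open>k = 1\<close> this is linear growth; in general it pulls a value
  at \<open>m\<close> back to one at a fixed fraction of \<open>m\<close>.\<close>

lemma upper_fundamental_mult_le:
  fixes x :: "nat \<Rightarrow> 'a::real_normed_vector"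
  assumes "bounded (range x)"
  shows "upper_fundamental x (j * k) \<le> real j * upper_fundamental x k"
proof (rule upper_fundamental_le)
  fix A :: "nat set"
  assume "finite A" "card A \<le> j * k"
  then show "norm (\<Sum>n\<in>A. x n) \<le> real j * upper_fundamental x k"
  proof (induction j arbitrary: A)
    case 0
    then show ?case by simp
  next
    case (Suc j)
    obtain B where B: "B \<subseteq> A" "card B = min k (card A)"
      by (rule obtain_subset_with_card_n[of "min k (card A)" A]) simp_all
    have fB: "finite B" using B(1) Suc.prems(1) by (rule finite_subset)
    have "card (A - B) \<le> j * k"
      using B Suc.prems(2) fB by (simp add: card_Diff_subset)
    then have 1: "norm (\<Sum>n\<in>A - B. x n) \<le> real j * upper_fundamental x k"
      using Suc.prems(1) by (intro Suc.IH) auto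
    have 2: "norm (\<Sum>n\<in>B. x n) \<le> upper_fundamental x k"
      using B fB by (intro norm_sum_le_upper_fundamental assms) auto
    have "(\<Sum>n\<in>A. x n) = (\<Sum>n\<in>A - B. x n) + (\<Sum>n\<in>B. x n)"
      using B(1) Suc.prems(1) by (rule sum.subset_diff)
    then have "norm (\<Sum>n\<in>A. x n) \<le> norm (\<Sum>n\<in>A - B. x n) + norm (\<Sum>n\<in>B. x n)"
      by (simp only: norm_triangle_ineq)
    with 1 2 show ?case by (simp add: algebra_simps)
  qed
qed

section \<open>The duality inequality\<close>

text \<open>Built greedily: a maximiser over the rest of \<open>A\<close> joins the \<open>k\<close>
  largest, so ties need no separate treatment.\<close>

lemma ex_largest_subset:
  fixes g :: "'i \<Rightarrow> real"
  assumes "finite A" "k \<le> card A"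
  shows "\<exists>S\<subseteq>A. card S = k \<and> (\<forall>i\<in>S. \<forall>j\<in>A - S. g j \<le> g i)"
  using assms(2)
proof (induction k)
  case 0
  then show ?case by (intro exI[of _ "{}"]) auto
next
  case (Suc k)
  then obtain S where S: "S \<subseteq> A" "card S = k" "\<forall>i\<in>S. \<forall>j\<in>A - S. g j \<le> g i"
    by auto
  have fin: "finite (A - S)" "finite S" using assms S finite_subset by auto
  have ne: "A - S \<noteq> {}"
    using S Suc.prems fin by (metis Diff_eq_empty_iff not_less_eq_eq order_refl subset_antisym)
  have "Max (g ` (A - S)) \<in> g ` (A - S)"
    using fin ne by (intro Max_in) auto
  then obtain p where p: "p \<in> A - S" "g p = Max (g ` (A - S))"
    by auto
  have "\<forall>j\<in>A - S. g j \<le> g p"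
    using fin p by auto
  with S p fin show ?case
    by (intro exI[of _ "insert p S"]) auto
qed

text \<open>
  The scalars \<open>a n\<close> play the role of the coefficients of a vector of norm one that almost
  norms \<open>\<Sum>n\<in>A. u n\<close>, where \<open>w\<close> is biorthogonal to \<open>u\<close>.
\<close>

definition has_test_coefficients ::
    "'k::real_normed_field itself \<Rightarrow> (nat \<Rightarrow> 'a::real_normed_vector) \<Rightarrow>
      (nat \<Rightarrow> 'b::real_normed_vector) \<Rightarrow> real \<Rightarrow> bool"
  where "has_test_coefficients TYPE('k) u w K \<longleftrightarrow>
    (\<forall>A. finite A \<longrightarrow> (\<exists>a :: nat \<Rightarrow> 'k.
      norm (\<Sum>n\<in>A. u n) \<le> K * norm (\<Sum>n\<in>A. a n) \<and>
      (\<forall>S. finite S \<longrightarrow> norm (\<Sum>n\<in>S. a n) \<le> norm (\<Sum>n\<in>S. u n)) \<and>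
      (\<forall>S t. finite S \<longrightarrow> (\<forall>n\<in>S. t \<le> norm (a n)) \<longrightarrow> t * norm (\<Sum>n\<in>S. w n) \<le> K)))"

section \<open>Domination of near sets by far ones\<close>

definition far_dominated :: "(nat \<Rightarrow> 'a::real_normed_vector) \<Rightarrow> real \<Rightarrow> nat set \<Rightarrow> nat set \<Rightarrow> bool"
  where "far_dominated u C D E \<longleftrightarrow>
    (\<forall>A B. A \<subseteq> D \<longrightarrow> finite B \<longrightarrow> B \<subseteq> - E \<longrightarrow> card A \<le> card B \<longrightarrow>
      norm (\<Sum>n\<in>A. u n) \<le> C * norm (\<Sum>n\<in>B. u n))"

lemma far_dominatedD:
  assumes "far_dominated u C D E" "A \<subseteq> D" "finite B" "B \<subseteq> - E" "card A \<le> card B"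
  shows "norm (\<Sum>n\<in>A. u n) \<le> C * norm (\<Sum>n\<in>B. u n)"
  using assms unfolding far_dominated_def by simp

lemma far_dominated_mono:
  assumes "far_dominated u C D E" "C \<le> C'"
  shows "far_dominated u C' D E"
  unfolding far_dominated_def
proof (intro allI impI)
  fix A B
  assume "A \<subseteq> D" "finite B" "B \<subseteq> - E" "card A \<le> card B"
  then have "norm (\<Sum>n\<in>A. u n) \<le> C * norm (\<Sum>n\<in>B. u n)"
    by (rule far_dominatedD[OF assms(1)])
  also have "\<dots> \<le> C' * norm (\<Sum>n\<in>B. u n)"
    using assms(2) by (simp add: mult_right_mono)
  finally show "norm (\<Sum>n\<in>A. u n) \<le> C' * norm (\<Sum>n\<in>B. u n)" .
qed

lemma partially_democraticE:
  fixes u :: "nat \<Rightarrow> 'a::real_normed_vector"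
  assumes "partially_democratic u"
  obtains C where "C \<ge> 1" "\<And>D. finite D \<Longrightarrow> \<exists>E. finite E \<and> far_dominated u C D E"
proof -
  from assms obtain C where
    "\<forall>D. finite D \<longrightarrow> (\<exists>E. finite E \<and> D \<subseteq> E \<and> far_dominated u C D E)"
    unfolding partially_democratic_def far_dominated_def[symmetric] by (elim exE)
  then have "\<exists>E. finite E \<and> far_dominated u (max 1 C) D E" if "finite D" for D
    using that far_dominated_mono[of u C D _ "max 1 C"] by (meson max.cobounded2)
  then show thesis by (intro that[of "max 1 C"]) auto
qed

text \<open>
  The set \<open>A\<close> is first moved far away, where the \<open>k\<close> largest test coefficients sit on a set
  that dominates \<open>B\<close>. Since partial democracy compares near sets with far ones only, this
  is what makes both hypotheses applicable.
\<close>

lemma duality_inequality: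
  fixes u :: "nat \<Rightarrow> 'a::real_normed_vector" and w :: "nat \<Rightarrow> 'b::real_normed_vector"
  assumes bu: "bounded (range u)" and bw: "bounded (range w)"
    and "partially_democratic u" "partially_democratic w"
    and test: "has_test_coefficients TYPE('k::real_normed_field) u w K"
  obtains P where "P \<ge> 1"
    "\<And>k m. k \<le> m \<Longrightarrow> upper_fundamental u m * upper_fundamental w k
      \<le> P * (upper_fundamental u k * upper_fundamental w k) + P * real m"
proof -
  let ?\<phi> = "upper_fundamental u" and ?\<psi> = "upper_fundamental w"
  obtain C where C: "C \<ge> 1" "\<And>D. finite D \<Longrightarrow> \<exists>E. finite E \<and> far_dominated u C D E"
    using partially_democraticE[OF assms(3)] by metis
  obtain C' where C': "C' \<ge> 1" "\<And>D. finite D \<Longrightarrow> \<exists>E. finite E \<and> far_dominated w C' D E"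
    using partially_democraticE[OF assms(4)] by metis
  define L where "L = max 1 K"
  have L: "L \<ge> 1" "K \<le> L" by (auto simp: L_def)
  \<comment> \<open>\<open>C * L\<close> is the cost of replacing \<open>A\<close> by test
    coefficients on a far set, \<open>C' * L\<close> that of bounding \<open>t\<close> times the
    norm on \<open>B\<close>.\<close>
  define P where "P = C * L * (C' * L)"
  have CL: "1 \<le> C * L" "1 \<le> C' * L"
    using C(1) C'(1) L mult_mono[of 1 C 1 L] mult_mono[of 1 C' 1 L] by auto
  then have P: "P \<ge> 1" "C * L \<le> P"
    using mult_mono[of 1 "C * L" 1 "C' * L"] mult_left_mono[of 1 "C' * L" "C * L"]
    by (auto simp: P_def)
  \<comment> \<open>Individual sets come first; the suprema over \<open>B\<close> and then over
    \<open>A\<close> are taken afterwards.\<close>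
  have pair: "norm (\<Sum>n\<in>A. u n) * norm (\<Sum>n\<in>B. w n) \<le> P * (?\<phi> k * ?\<psi> k) + P * real m"
    if A: "finite A" "card A \<le> m" and B: "finite B" "card B \<le> k" and km: "k \<le> m" for A B k m
  proof -
    have nn: "0 \<le> ?\<phi> k" "0 \<le> ?\<psi> k" using bu bw upper_fundamental_nonneg by auto
    have B': "norm (\<Sum>n\<in>B. w n) \<le> ?\<psi> k"
      using B by (intro norm_sum_le_upper_fundamental bw)
    show ?thesis
    \<comment> \<open>If \<open>card A > k\<close>, then \<open>k\<close> indices of a set of that
      size leave a nonempty remainder, over which a maximum can be taken.\<close>
    proof (cases "card A \<le> k")
      case True
      then have "norm (\<Sum>n\<in>A. u n) \<le> ?\<phi> k"
        using A by (intro norm_sum_le_upper_fundamental bu)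
      then have "norm (\<Sum>n\<in>A. u n) * norm (\<Sum>n\<in>B. w n) \<le> ?\<phi> k * ?\<psi> k"
        using B' nn by (intro mult_mono) auto
      also have "\<dots> \<le> P * (?\<phi> k * ?\<psi> k)"
        using P nn mult_right_mono[of 1 P "?\<phi> k * ?\<psi> k"] by simp
      finally show ?thesis
        using P by (simp add: add_increasing2)
    next
      case False
      obtain E where E: "finite E" "far_dominated u C A E"
        using C(2)[OF A(1)] by auto
      obtain E' where E': "finite E'" "far_dominated w C' B E'"
        using C'(2)[OF B(1)] by auto
      have "infinite (- (E \<union> E'))"
        using E(1) E'(1) by (simp add: Compl_eq_Diff_UNIV)
      then obtain G where G: "finite G" "card G = card A" "G \<subseteq> - (E \<union> E')"
        using infinite_arbitrarily_large by blast
      obtain a :: "nat \<Rightarrow> 'k" where a1: "norm (\<Sum>n\<in>G. u n) \<le> K * norm (\<Sum>n\<in>G. a n)"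
        and a2: "\<forall>S. finite S \<longrightarrow> norm (\<Sum>n\<in>S. a n) \<le> norm (\<Sum>n\<in>S. u n)"
        and a3: "\<forall>S t. finite S \<longrightarrow> (\<forall>n\<in>S. t \<le> norm (a n)) \<longrightarrow> t * norm (\<Sum>n\<in>S. w n) \<le> K"
        using test[unfolded has_test_coefficients_def, THEN spec, THEN mp, OF G(1)]
        by (elim exE conjE) (rule that)
      obtain S where S: "S \<subseteq> G" "card S = k" "\<forall>i\<in>S. \<forall>j\<in>G - S. norm (a j) \<le> norm (a i)"
        using ex_largest_subset[of G k "\<lambda>n. norm (a n)"] G False by auto
      have fin: "finite S" "finite (G - S)" using S G finite_subset by auto
      have ne: "G - S \<noteq> {}"
        using S G False by (metis Diff_eq_empty_iff order_refl subset_antisym)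
      \<comment> \<open>\<open>t\<close> separates the two groups: it bounds the coefficients off
        \<open>S\<close> from above and those on \<open>S\<close> from below.\<close>
      define t where "t = Max ((\<lambda>n. norm (a n)) ` (G - S))"
      have t1: "norm (a n) \<le> t" if "n \<in> G - S" for n
        using that fin by (auto simp: t_def)
      have t2: "t \<le> norm (a n)" if "n \<in> S" for n
        unfolding t_def using that fin ne S by (subst Max_le_iff) auto
      have t0: "t \<ge> 0" using t1 ne by (metis all_not_in_conv norm_ge_zero order_trans)
      have "norm (\<Sum>n\<in>A. u n) \<le> C * norm (\<Sum>n\<in>G. u n)"
        using G by (intro far_dominatedD[OF E(2)]) auto
      also have "norm (\<Sum>n\<in>G. u n) \<le> L * norm (\<Sum>n\<in>G. a n)"
        by (rule order_trans[OF a1]) (use L in \<open>simp add: mult_right_mono\<close>)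
      also have "(\<Sum>n\<in>G. a n) = (\<Sum>n\<in>G - S. a n) + (\<Sum>n\<in>S. a n)"
        using S G by (intro sum.subset_diff) auto
      also have "norm \<dots> \<le> norm (\<Sum>n\<in>G - S. a n) + norm (\<Sum>n\<in>S. a n)"
        by (rule norm_triangle_ineq)
      also have "norm (\<Sum>n\<in>G - S. a n) \<le> real (card (G - S)) * t"
        using t1 by (intro sum_norm_bound)
      also have "\<dots> \<le> real m * t"
        using t0 G(1,2) A(2) card_mono[of G "G - S"] by (intro mult_right_mono) auto
      also have "norm (\<Sum>n\<in>S. a n) \<le> ?\<phi> k"
        using a2[rule_format, OF fin(1)] norm_sum_le_upper_fundamental[OF bu fin(1), of k] S by simp
      finally have uA: "norm (\<Sum>n\<in>A. u n) \<le> C * (L * (real m * t + ?\<phi> k))"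
        using C(1) L by (simp add: mult_left_mono)
      \<comment> \<open>The test property on \<open>S\<close> at level \<open>t\<close> bounds this
        product; keeping \<open>t\<close> as a factor avoids dividing by a norm that may
        vanish.\<close>
      have "t * norm (\<Sum>n\<in>B. w n) \<le> t * (C' * norm (\<Sum>n\<in>S. w n))"
        using t0 S G fin B by (intro mult_left_mono far_dominatedD[OF E'(2)]) auto
      also have "\<dots> = C' * (t * norm (\<Sum>n\<in>S. w n))" by simp
      also have "\<dots> \<le> C' * L"
        using a3[rule_format, of S t] t2 fin C' L by (intro mult_left_mono) auto
      finally have tB: "t * norm (\<Sum>n\<in>B. w n) \<le> C' * L" .
      have "norm (\<Sum>n\<in>A. u n) * norm (\<Sum>n\<in>B. w n)
          \<le> (C * (L * (real m * t + ?\<phi> k))) * norm (\<Sum>n\<in>B. w n)"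
        using uA by (intro mult_right_mono) auto
      also have "\<dots> = (C * L) * (?\<phi> k * norm (\<Sum>n\<in>B. w n))
          + (C * L) * (real m * (t * norm (\<Sum>n\<in>B. w n)))"
        by (simp add: algebra_simps)
      also have "\<dots> \<le> P * (?\<phi> k * ?\<psi> k) + (C * L) * (real m * (C' * L))"
        using tB B' nn P CL(1)
        by (intro add_mono mult_mono[of "C * L" P] mult_left_mono) auto
      finally show ?thesis by (simp add: P_def mult_ac)
    qed
  qed
  have "?\<phi> m * ?\<psi> k \<le> P * (?\<phi> k * ?\<psi> k) + P * real m" (is "_ \<le> ?R") if km: "k \<le> m" for k m
  proof -
    have R: "0 \<le> ?R"
      using P upper_fundamental_nonneg[OF bu] upper_fundamental_nonneg[OF bw]
      by (intro add_nonneg_nonneg mult_nonneg_nonneg) auto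
    \<comment> \<open>Passing to a supremum requires division by the other factor, so a vanishing
      factor is treated apart.\<close>
    have 1: "norm (\<Sum>n\<in>A. u n) * ?\<psi> k \<le> ?R" if A: "finite A" "card A \<le> m" for A
    proof (cases "norm (\<Sum>n\<in>A. u n) = 0")
      case True
      then show ?thesis using R by simp
    next
      case False
      then have pos: "norm (\<Sum>n\<in>A. u n) > 0" by simp
      have "?\<psi> k \<le> ?R / norm (\<Sum>n\<in>A. u n)"
        using pair[OF A _ _ km] pos
        by (intro upper_fundamental_le) (simp add: pos_le_divide_eq mult.commute)
      with pos show ?thesis by (simp add: pos_le_divide_eq mult.commute)
    qed
    show ?thesis
    proof (cases "?\<psi> k = 0")
      case True
      then show ?thesis using R by simp
    next
      case False
      then have pos: "?\<psi> k > 0" using upper_fundamental_nonneg[OF bw, of k] by simp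
      have "?\<phi> m \<le> ?R / ?\<psi> k"
        using 1 pos by (intro upper_fundamental_le) (simp add: pos_le_divide_eq)
      with pos show ?thesis by (simp add: pos_le_divide_eq)
    qed
  qed
  with P(1) show thesis by (rule that)
qed

text \<open>
  Induction on \<open>m\<close>, comparing \<open>m\<close> with \<open>k = m div N\<close>. Either the product of the fundamental
  functions at \<open>k\<close> is already \<open>O(m)\<close>, or both fundamental functions grow by at most a constant
  factor from \<open>k\<close> to \<open>m\<close>, and the factor \<open>N\<close> gained in the induction hypothesis beats it.
\<close>

lemma upper_fundamental_product_bound:
  fixes u :: "nat \<Rightarrow> 'a::real_normed_vector" and w :: "nat \<Rightarrow> 'b::real_normed_vector"
  assumes bu: "bounded (range u)" and bw: "bounded (range w)"
    and pu: "partially_democratic u" and pw: "partially_democratic w"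
    and tuw: "has_test_coefficients TYPE('k::real_normed_field) u w K"
    and twu: "has_test_coefficients TYPE('k) w u K'"
  shows "\<exists>\<Delta>. \<forall>m. upper_fundamental u m * upper_fundamental w m \<le> \<Delta> * real m"
proof -
  let ?\<phi> = "upper_fundamental u" and ?\<psi> = "upper_fundamental w"
  obtain P1 where P1: "P1 \<ge> 1" "\<And>k m. k \<le> m \<Longrightarrow>
      ?\<phi> m * ?\<psi> k \<le> P1 * (?\<phi> k * ?\<psi> k) + P1 * real m"
    using duality_inequality[OF bu bw pu pw tuw] by blast
  obtain P2 where P2: "P2 \<ge> 1" "\<And>k m. k \<le> m \<Longrightarrow>
      ?\<psi> m * ?\<phi> k \<le> P2 * (?\<psi> k * ?\<phi> k) + P2 * real m"
    using duality_inequality[OF bw bu pw pu twu] by blast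
  have nn: "0 \<le> ?\<phi> k" "0 \<le> ?\<psi> k" for k using bu bw upper_fundamental_nonneg by auto
  define P where "P = max P1 P2"
  have P: "P \<ge> 1" using P1(1) by (auto simp: P_def)
  have le: "P' * s + P' * real m \<le> P * s + P * real m" if "P' \<le> P" "0 \<le> s" for P' s m
    using that by (intro add_mono mult_right_mono) auto
  have I: "?\<phi> m * ?\<psi> k \<le> P * (?\<phi> k * ?\<psi> k) + P * real m" if "k \<le> m" for k m
    by (rule order_trans[OF P1(2)[OF that] le]) (use nn in \<open>auto simp: P_def\<close>)
  have II: "?\<psi> m * ?\<phi> k \<le> P * (?\<phi> k * ?\<psi> k) + P * real m" if "k \<le> m" for k m
    by (rule order_trans[OF P2(2)[OF that, unfolded mult.commute[of "?\<psi> k"]] le])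
      (use nn in \<open>auto simp: P_def\<close>)
  \<comment> \<open>In the inductive case both functions grow by at most \<open>2 * P\<close> from
    \<open>k\<close> to \<open>m\<close>, so \<open>N\<close> must reach the square of this
    factor.\<close>
  define N where "N = nat \<lceil>4 * P\<^sup>2\<rceil>"
  have N: "4 * P\<^sup>2 \<le> real N" unfolding N_def by linarith
  have "1 \<le> P\<^sup>2" using P by simp
  then have N0: "N > 0" using N by (auto intro: Nat.gr0I)
  \<comment> \<open>The first entry serves \<open>m < N\<close>, the second the case in which the
    product at \<open>k\<close> is at most \<open>m\<close>.\<close>
  define \<Delta> where "\<Delta> = max (real N * (?\<phi> 1 * ?\<psi> 1)) (4 * real N * P)"
  have \<Delta>0: "\<Delta> \<ge> 0" using P nn by (simp add: \<Delta>_def le_max_iff_disj)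
  have "?\<phi> m * ?\<psi> m \<le> \<Delta> * real m" for m
  proof (induction m rule: less_induct)
    case (less m)
    define k where "k = m div N"
    show ?case
    proof (cases "k = 0")
      case True
      then have "m < N" using N0 by (auto simp: k_def div_eq_0_iff)
      \<comment> \<open>Below \<open>N\<close>, linear growth from \<open>1\<close> suffices: one of
        the two factors \<open>m\<close> is absorbed by \<open>N\<close>.\<close>
      have "?\<phi> m * ?\<psi> m \<le> (real m * ?\<phi> 1) * (real m * ?\<psi> 1)"
        using upper_fundamental_mult_le[OF bu, of m 1] upper_fundamental_mult_le[OF bw, of m 1] nn
        by (intro mult_mono) auto
      also have "\<dots> = (real m * (?\<phi> 1 * ?\<psi> 1)) * real m" by simp
      also have "\<dots> \<le> (real N * (?\<phi> 1 * ?\<psi> 1)) * real m"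
        using \<open>m < N\<close> nn by (intro mult_right_mono) auto
      also have "\<dots> \<le> \<Delta> * real m" by (intro mult_right_mono) (auto simp: \<Delta>_def)
      finally show ?thesis .
    next
      case False
      have kN: "k * N \<le> m" "m < (k + 1) * N"
        using dividend_less_div_times[OF N0, of m] by (simp_all add: k_def algebra_simps)
      have km: "k \<le> m" by (simp add: k_def)
      show ?thesis
      proof (cases "?\<phi> k * ?\<psi> k \<le> real m")
        case True
        \<comment> \<open>As \<open>k\<close> is at least \<open>1\<close>, \<open>m\<close> is at
          most \<open>2 * N * k\<close>. Only \<open>?\<psi>\<close> is moved from \<open>m\<close>
          to \<open>k\<close>, after which \<open>I\<close> applies.\<close>
        have "m \<le> (k + 1) * N" using kN(2) by (rule less_imp_le)
        also have "\<dots> \<le> (2 * k) * N" using \<open>k \<noteq> 0\<close> by (intro mult_le_mono1) auto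
        also have "\<dots> = (2 * N) * k" by simp
        finally have "?\<psi> m \<le> ?\<psi> ((2 * N) * k)"
          by (rule upper_fundamental_mono[OF bw])
        also have "\<dots> \<le> real (2 * N) * ?\<psi> k"
          by (rule upper_fundamental_mult_le[OF bw])
        finally have "?\<phi> m * ?\<psi> m \<le> ?\<phi> m * (real (2 * N) * ?\<psi> k)"
          using nn by (intro mult_left_mono)
        also have "\<dots> = real (2 * N) * (?\<phi> m * ?\<psi> k)" by simp
        also have "\<dots> \<le> real (2 * N) * (P * (?\<phi> k * ?\<psi> k) + P * real m)"
          using I[OF km] by (intro mult_left_mono) auto
        also have "\<dots> \<le> real (2 * N) * (P * real m + P * real m)"
          using True P by (intro mult_left_mono add_mono) auto
        also have "\<dots> = (4 * real N * P) * real m" by simp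
        also have "\<dots> \<le> \<Delta> * real m" by (intro mult_right_mono) (auto simp: \<Delta>_def)
        finally show ?thesis .
      next
        case False
        then have "?\<phi> k * ?\<psi> k > 0" by (meson le_less_trans not_le of_nat_0_le_iff)
        then have pos: "?\<phi> k > 0" "?\<psi> k > 0"
          using nn[of k] by (auto simp: zero_less_mult_iff)
        \<comment> \<open>A product above \<open>m\<close> absorbs the additive terms of
          \<open>I\<close> and \<open>II\<close>; cancelling the common factor leaves growth by at
          most \<open>2 * P\<close> in each function.\<close>
        have "P * real m \<le> P * (?\<phi> k * ?\<psi> k)"
          using False P by (intro mult_left_mono) auto
        then have "?\<phi> m * ?\<psi> k \<le> (2 * P * ?\<phi> k) * ?\<psi> k" "?\<psi> m * ?\<phi> k \<le> (2 * P * ?\<psi> k) * ?\<phi> k"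
          using I[OF km] II[OF km] by (auto simp: mult_ac)
        then have "?\<phi> m \<le> 2 * P * ?\<phi> k" "?\<psi> m \<le> 2 * P * ?\<psi> k"
          using pos by (simp_all only: mult_le_cancel_right_pos)
        then have "?\<phi> m * ?\<psi> m \<le> (2 * P * ?\<phi> k) * (2 * P * ?\<psi> k)"
          using nn P by (intro mult_mono) auto
        also have "\<dots> = 4 * P\<^sup>2 * (?\<phi> k * ?\<psi> k)" by (simp add: power2_eq_square)
        also have "\<dots> \<le> real N * (\<Delta> * real k)"
        proof (rule mult_mono[OF N])
          have "N > 1" using N \<open>1 \<le> P\<^sup>2\<close> by linarith
          with \<open>k \<noteq> 0\<close> have "k < m"
            by (auto simp: k_def intro!: div_less_dividend Nat.gr0I)
          then show "?\<phi> k * ?\<psi> k \<le> \<Delta> * real k" by (rule less)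
        qed (use nn in auto)
        also have "\<dots> = \<Delta> * real (k * N)" by simp
        also have "\<dots> \<le> \<Delta> * real m"
          using kN \<Delta>0 by (intro mult_left_mono) (simp_all only: of_nat_le_iff)
        finally show ?thesis .
      qed
    qed
  qed
  then show ?thesis by blast
qed

section \<open>Real parts and finite Hahn--Banach extension\<close>

text \<open>
  A uniform treatment of the two scalar fields: \<open>re\<close> is the real part and \<open>im_unit\<close> is
  the imaginary unit, which is taken to be \<open>0\<close> in the real case.
\<close>

locale real_part =
  fixes re :: "'k::real_normed_field \<Rightarrow> real" and im_unit :: 'k
  assumes re_add: "re (y + z) = re y + re z"
    and re_of_real_mult: "re (of_real r * z) = r * re z"
    and re_one: "re 1 = 1"
    and re_le_norm: "\<bar>re z\<bar> \<le> norm z"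
    and norm_im_unit_le: "norm im_unit \<le> 1"
    and decompose: "z = of_real (re z) - of_real (re (im_unit * z)) * im_unit"
begin

lemma re_of_real: "re (of_real r) = r"
  using re_of_real_mult[of r 1] re_one by simp

lemma re_zero: "re 0 = 0"
  using re_of_real[of 0] by simp

lemma re_sum: "re (\<Sum>n\<in>A. g n) = (\<Sum>n\<in>A. re (g n))"
  by (induction A rule: infinite_finite_induct) (auto simp: re_zero re_add)

lemma re_minus: "re (- z) = - re z"
  using re_of_real_mult[of "-1" z] by simp

lemma abs_re_im_unit_mult_le: "\<bar>re (im_unit * z)\<bar> \<le> norm z"
  by (rule order_trans[OF re_le_norm])
    (use norm_im_unit_le mult_right_mono[of "norm im_unit" 1 "norm z"] in \<open>simp add: norm_mult\<close>)

end

lemma real_part_real: "real_part (\<lambda>z::real. z) 0"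
  by unfold_locales auto

lemma real_part_complex: "real_part Re \<i>"
  by unfold_locales (auto simp: abs_Re_le_cmod complex_eq_iff)

text \<open>
  The set \<open>G\<close> is the graph of a functional dominated by the norm; stating dominated
  extension in terms of coefficients makes linear independence irrelevant.
\<close>

lemma dominated_extension_one:
  fixes G :: "('a::real_normed_vector \<times> real) set"
  assumes G: "subspace G" and le: "\<And>v l. (v, l) \<in> G \<Longrightarrow> l \<le> norm v"
  shows "\<exists>c. \<forall>v l t. (v, l) \<in> G \<longrightarrow> l + t * c \<le> norm (v + t *\<^sub>R s)"
proof -
  \<comment> \<open>An admissible value at \<open>s\<close> lies above every
    \<open>l - norm (v - s)\<close> and below every \<open>norm (v + s) - l\<close>. Additivity of
    \<open>G\<close> makes these bounds compatible.\<close>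
  define X where "X = (\<lambda>(v, l). l - norm (v - s)) ` G"
  have X_le: "y \<le> norm (v + s) - l" if "y \<in> X" "(v, l) \<in> G" for y v l
  proof -
    obtain v' l' where *: "(v', l') \<in> G" "y = l' - norm (v' - s)"
      using \<open>y \<in> X\<close> by (auto simp: X_def)
    have "(v' + v, l' + l) \<in> G"
      using subspace_add[OF G *(1) that(2)] by simp
    then have "l' + l \<le> norm (v' + v)" by (rule le)
    also have "\<dots> = norm ((v' - s) + (v + s))" by simp
    also have "\<dots> \<le> norm (v' - s) + norm (v + s)" by (rule norm_triangle_ineq)
    finally show ?thesis using * by simp
  qed
  have 0: "(0, 0) \<in> G" using subspace_0[OF G] by (simp add: zero_prod_def)
  then have X: "X \<noteq> {}" "bdd_above X"
    using X_le[OF _ 0] by (auto simp: X_def intro!: bdd_aboveI)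
  define c where "c = Sup X"
  have up: "c \<le> norm (v + s) - l" if "(v, l) \<in> G" for v l
    unfolding c_def using X X_le that by (intro cSup_least)
  have low: "l - norm (v - s) \<le> c" if "(v, l) \<in> G" for v l
    unfolding c_def using X that by (intro cSup_upper) (auto simp: X_def)
  have "l + t * c \<le> norm (v + t *\<^sub>R s)" if vl: "(v, l) \<in> G" for v l t
  proof -
    \<comment> \<open>The bounds \<open>up\<close> and \<open>low\<close> are the cases
      \<open>t = 1\<close> and \<open>t = -1\<close>; scaling by the inverse of the modulus of
      \<open>t\<close> reduces all other nonzero \<open>t\<close> to them.\<close>
    have scaled: "(r *\<^sub>R v, r * l) \<in> G" for r
      using subspace_scale[OF G vl, of r] by simp
    consider "t = 0" | "t > 0" | "t < 0" by linarith
    then show ?thesis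
    proof cases
      case 1
      then show ?thesis using le[OF vl] by simp
    next
      case 2
      have "t * (c + inverse t * l) \<le> t * norm (inverse t *\<^sub>R v + s)"
        using up[OF scaled[of "inverse t"]] 2 by (intro mult_left_mono) auto
      also have "\<dots> = norm (t *\<^sub>R (inverse t *\<^sub>R v + s))" using 2 by simp
      also have "t *\<^sub>R (inverse t *\<^sub>R v + s) = v + t *\<^sub>R s"
        using 2 by (simp add: scaleR_add_right)
      finally show ?thesis using 2 by (simp add: algebra_simps)
    next
      case 3
      define r where "r = - t"
      have r: "r > 0" using 3 by (simp add: r_def)
      have "r * (inverse r * l - c) \<le> r * norm (inverse r *\<^sub>R v - s)"
        using low[OF scaled[of "inverse r"]] r by (intro mult_left_mono) auto
      also have "\<dots> = norm (r *\<^sub>R (inverse r *\<^sub>R v - s))" using r by simp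
      also have "r *\<^sub>R (inverse r *\<^sub>R v - s) = v + t *\<^sub>R s"
        using r by (simp add: scaleR_diff_right r_def)
      finally show ?thesis using r by (simp add: algebra_simps r_def)
    qed
  qed
  then show ?thesis by blast
qed

text \<open>One vector at a time: once a value \<open>d\<close> is chosen for \<open>s j\<close>,
  the line through \<open>(s j, d)\<close> is added to the graph and induction does the
  rest.\<close>

lemma dominated_extension:
  fixes G :: "('a::real_normed_vector \<times> real) set"
  assumes "finite I" "subspace G" "\<And>v l. (v, l) \<in> G \<Longrightarrow> l \<le> norm v"
  shows "\<exists>c. \<forall>v l t. (v, l) \<in> G \<longrightarrow>
    l + (\<Sum>i\<in>I. t i * c i) \<le> norm (v + (\<Sum>i\<in>I. t i *\<^sub>R s i))"
  using assms
proof (induction I arbitrary: G rule: finite_induct)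
  case empty
  then show ?case by simp
next
  case (insert j I)
  obtain d where d: "\<And>v l t. (v, l) \<in> G \<Longrightarrow> l + t * d \<le> norm (v + t *\<^sub>R s j)"
    using dominated_extension_one[OF insert.prems] by metis
  define H where "H = {y + z | y z. y \<in> G \<and> z \<in> range (\<lambda>t. t *\<^sub>R (s j, d))}"
  have "subspace (range (\<lambda>t. t *\<^sub>R (s j, d)))"
    using subspace_span[of "{(s j, d)}"] by (simp add: span_singleton)
  then have "subspace H"
    unfolding H_def using insert.prems(1) by (intro subspace_sums) auto
  moreover have "l \<le> norm v" if "(v, l) \<in> H" for v l
    using that d by (auto simp: H_def)
  ultimately obtain c where c: "\<And>v l t. (v, l) \<in> H \<Longrightarrow>
      l + (\<Sum>i\<in>I. t i * c i) \<le> norm (v + (\<Sum>i\<in>I. t i *\<^sub>R s i))"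
    using insert.IH by metis
  have "l + (\<Sum>i\<in>insert j I. t i * (c(j := d)) i)
      \<le> norm (v + (\<Sum>i\<in>insert j I. t i *\<^sub>R s i))" if "(v, l) \<in> G" for v l t
  proof -
    have "(v + t j *\<^sub>R s j, l + t j * d) \<in> H"
      unfolding H_def using that by (intro CollectI exI conjI rangeI) auto
    from c[OF this, of t] have "l + (t j * d + (\<Sum>i\<in>I. t i * c i))
        \<le> norm (v + (t j *\<^sub>R s j + (\<Sum>i\<in>I. t i *\<^sub>R s i)))"
      by (simp add: add.assoc)
    moreover have "(\<Sum>i\<in>I. t i * (c(j := d)) i) = (\<Sum>i\<in>I. t i * c i)"
      using insert.hyps by (intro sum.cong) auto
    ultimately show ?thesis using insert.hyps by simp
  qed
  then show ?case by blast
qed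

section \<open>Truncation quasi-greedy sequences\<close>

text \<open>The norm is convex in each \<open>b n\<close>, so it is controlled at the vertices of
  the cube, where the sum becomes a subset sum. The offset \<open>y\<close> carries the terms fixed
  earlier in the induction.\<close>

lemma norm_convex_subset_sum_le:
  fixes z :: "'i \<Rightarrow> 'a::real_normed_vector"
  assumes "finite T" "\<And>B. B \<subseteq> T \<Longrightarrow> norm (y + (\<Sum>n\<in>B. z n)) \<le> K"
    and "\<And>n. n \<in> T \<Longrightarrow> 0 \<le> b n \<and> b n \<le> (1::real)"
  shows "norm (y + (\<Sum>n\<in>T. b n *\<^sub>R z n)) \<le> K"
  using assms
proof (induction T arbitrary: y rule: finite_induct)
  case empty
  then show ?case by force
next
  case (insert j T)
  let ?s = "\<Sum>n\<in>T. b n *\<^sub>R z n"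
  have 1: "norm (y + ?s) \<le> K"
    using insert.prems by (intro insert.IH) auto
  have 2: "norm ((y + z j) + ?s) \<le> K"
  proof (rule insert.IH)
    show "norm ((y + z j) + (\<Sum>n\<in>B. z n)) \<le> K" if "B \<subseteq> T" for B
    proof -
      have "finite B" "j \<notin> B" using that insert.hyps finite_subset by auto
      then show ?thesis
        using insert.prems(1)[of "insert j B"] that by (auto simp: add.assoc)
    qed
  qed (use insert.prems in auto)
  have b: "0 \<le> b j" "b j \<le> 1" using insert.prems by auto
  have "y + (\<Sum>n\<in>insert j T. b n *\<^sub>R z n) = (1 - b j) *\<^sub>R (y + ?s) + b j *\<^sub>R ((y + z j) + ?s)"
    using insert.hyps by (simp add: algebra_simps)
  also have "norm \<dots> \<le> norm ((1 - b j) *\<^sub>R (y + ?s)) + norm (b j *\<^sub>R ((y + z j) + ?s))"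
    by (rule norm_triangle_ineq)
  also have "\<dots> = (1 - b j) * norm (y + ?s) + b j * norm ((y + z j) + ?s)"
    using b by simp
  also have "\<dots> \<le> (1 - b j) * K + b j * K"
    using b 1 2 by (intro add_mono mult_left_mono) auto
  finally show ?case by (simp add: algebra_simps)
qed

text \<open>The positive and negative parts of \<open>b\<close> take values in the unit interval,
  and each costs \<open>K\<close>.\<close>

lemma norm_real_multiplier_le:
  fixes z :: "'i \<Rightarrow> 'a::real_normed_vector"
  assumes T: "finite T" and K: "\<And>B. B \<subseteq> T \<Longrightarrow> norm (\<Sum>n\<in>B. z n) \<le> K"
    and b: "\<And>n. n \<in> T \<Longrightarrow> \<bar>b n\<bar> \<le> (1::real)"
  shows "norm (\<Sum>n\<in>T. b n *\<^sub>R z n) \<le> 2 * K"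
proof -
  have 1: "norm (\<Sum>n\<in>T. c n *\<^sub>R z n) \<le> K" if "\<And>n. n \<in> T \<Longrightarrow> 0 \<le> c n \<and> c n \<le> 1" for c
    using norm_convex_subset_sum_le[of T 0 z K c] T K that by simp
  have "(\<Sum>n\<in>T. b n *\<^sub>R z n)
      = (\<Sum>n\<in>T. max 0 (b n) *\<^sub>R z n) - (\<Sum>n\<in>T. max 0 (- b n) *\<^sub>R z n)"
    unfolding sum_subtractf[symmetric]
    by (intro sum.cong) (auto simp: max_def simp flip: scaleR_diff_left)
  also have "norm \<dots> \<le> norm (\<Sum>n\<in>T. max 0 (b n) *\<^sub>R z n) + norm (\<Sum>n\<in>T. max 0 (- b n) *\<^sub>R z n)"
    by (rule norm_triangle_ineq4)
  also have "\<dots> \<le> K + K"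
    using b by (intro add_mono 1) (fastforce simp: abs_le_iff)+
  finally show ?thesis by simp
qed

text \<open>Used twice, for a basis with its dual functionals and for the dual basis with
  evaluations at the basis vectors, so that one proof of the truncation estimate serves
  both.\<close>

locale coefficient_system = normed_space_over smul + real_part re im_unit
  for smul :: "'k::real_normed_field \<Rightarrow> 'a::real_normed_vector \<Rightarrow> 'a"
    and re :: "'k \<Rightarrow> real" and im_unit :: 'k +
  fixes x :: "nat \<Rightarrow> 'a" and c :: "nat \<Rightarrow> 'a \<Rightarrow> 'k" and M :: real
  assumes c_add: "c n (f + g) = c n f + c n g"
    and c_smul: "c n (smul a f) = a * c n f"
    and c_bound: "norm (c n f) \<le> M * norm f"
    and c_biorth: "c n (x k) = (if n = k then 1 else 0)"
begin

lemma c_zero: "c n 0 = 0"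
  using c_smul[of n 0 0] by simp

lemma c_diff: "c n (f - g) = c n f - c n g"
  using c_add[of n "f - g" g] by simp

lemma c_scaleR: "c n (r *\<^sub>R f) = of_real r * c n f"
  using c_smul[of n "of_real r" f] by (simp add: smul_of_real)

lemma c_sum: "c n (\<Sum>i\<in>A. f i) = (\<Sum>i\<in>A. c n (f i))"
  by (induction A rule: infinite_finite_induct) (auto simp: c_zero c_add)

lemma c_sum_smul:
  assumes "finite A"
  shows "c n (\<Sum>k\<in>A. smul (a k) (x k)) = (if n \<in> A then a n else 0)"
  using assms by (simp add: c_sum c_smul c_biorth if_distrib[of "\<lambda>y. _ * y"] cong: if_cong)

lemma c_indicator:
  assumes "finite A"
  shows "c n (\<Sum>k\<in>A. x k) = (if n \<in> A then 1 else 0)"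
  using assms by (simp add: c_sum c_biorth)

lemma M_pos: "M > 0"
proof -
  have "norm (c 0 (x 0)) \<le> M * norm (x 0)" by (rule c_bound)
  then have "1 \<le> M * norm (x 0)" by (simp add: c_biorth)
  then show ?thesis
    by (metis less_le_trans norm_ge_zero not_le mult_nonpos_nonneg zero_less_one not_one_le_zero order_trans)
qed

section \<open>Decay of coefficients and bounded multipliers\<close>

lemma sum_smul_in_closed_span:
  "(\<Sum>k\<in>A. smul (a k) (x k)) \<in> closed_span smul (range x)"
  unfolding closed_span_def
  by (rule subsetD[OF closure_subset]) (intro span_sum span_scale span_base rangeI)

text \<open>A finite combination within \<open>t / M\<close> of \<open>f\<close> has coefficients
  differing from those of \<open>f\<close> by less than \<open>t\<close>, so coefficients of size
  \<open>t\<close> occur only on its finite support.\<close>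

lemma finite_large_coefficients:
  assumes f: "f \<in> closed_span smul (range x)" and t: "t > 0"
  shows "finite {n. t \<le> norm (c n f)}"
proof -
  obtain g where g: "g \<in> span (range x)" "dist g f < t / M"
    using f t M_pos unfolding closed_span_def closure_approachable by (meson divide_pos_pos)
  from g(1) have "finite {n. c n g \<noteq> 0}"
  proof (induction rule: span_induct_alt)
    case base
    then show ?case by (simp add: c_zero)
  next
    case (step a y h)
    then obtain k where k: "y = x k" by auto
    have "{n. c n (smul a y + h) \<noteq> 0} \<subseteq> insert k {n. c n h \<noteq> 0}"
      by (auto simp: k c_add c_smul c_biorth)
    with step show ?case by (meson finite_insert finite_subset)
  qed
  moreover have "{n. t \<le> norm (c n f)} \<subseteq> {n. c n g \<noteq> 0}"
  proof (intro subsetI CollectI notI)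
    fix n
    assume n: "n \<in> {n. t \<le> norm (c n f)}" "c n g = 0"
    have "norm (c n (f - g)) \<le> M * norm (f - g)" by (rule c_bound)
    also have "\<dots> < M * (t / M)"
      using g(2) M_pos by (intro mult_strict_left_mono) (auto simp: dist_norm norm_minus_commute)
    finally show False using n M_pos by (simp add: c_diff)
  qed
  ultimately show ?thesis by (rule finite_subset[rotated])
qed

text \<open>In the complex case \<open>re (im_unit * a)\<close> is minus the imaginary part of
  \<open>a\<close>, hence the sign; in the real case the second term vanishes.\<close>

lemma smul_decompose:
  "smul a v = re a *\<^sub>R v - smul im_unit (re (im_unit * a) *\<^sub>R v)"
proof -
  have "smul a v = smul (of_real (re a) - of_real (re (im_unit * a)) * im_unit) v"
    using decompose[of a] by simp
  also have "\<dots> = re a *\<^sub>R v - smul (im_unit * of_real (re (im_unit * a))) v"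
    by (simp add: scale_left_diff_distrib smul_of_real mult.commute)
  also have "smul (im_unit * of_real (re (im_unit * a))) v
      = smul im_unit (re (im_unit * a) *\<^sub>R v)"
    by (simp flip: smul_of_real scale_scale)
  finally show ?thesis .
qed

text \<open>The real and imaginary parts of \<open>b\<close> act as two real multipliers, each at
  cost \<open>2 * K\<close>.\<close>

lemma norm_multiplier_le:
  assumes T: "finite T" and K: "\<And>B. B \<subseteq> T \<Longrightarrow> norm (\<Sum>n\<in>B. z n) \<le> K"
    and b: "\<And>n. n \<in> T \<Longrightarrow> norm (b n) \<le> 1"
  shows "norm (\<Sum>n\<in>T. smul (b n) (z n)) \<le> 4 * K"
proof -
  have 1: "norm (\<Sum>n\<in>T. re (b n) *\<^sub>R z n) \<le> 2 * K"
    using T K by (rule norm_real_multiplier_le) (use b re_le_norm order_trans in blast)+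
  have 2: "norm (\<Sum>n\<in>T. re (im_unit * b n) *\<^sub>R z n) \<le> 2 * K"
    using T K by (rule norm_real_multiplier_le) (use b abs_re_im_unit_mult_le order_trans in blast)+
  have "(\<Sum>n\<in>T. smul (b n) (z n))
      = (\<Sum>n\<in>T. re (b n) *\<^sub>R z n) - smul im_unit (\<Sum>n\<in>T. re (im_unit * b n) *\<^sub>R z n)"
    by (subst smul_decompose) (simp add: sum_subtractf scale_sum_right)
  also have "norm \<dots> \<le> norm (\<Sum>n\<in>T. re (b n) *\<^sub>R z n)
      + norm (smul im_unit (\<Sum>n\<in>T. re (im_unit * b n) *\<^sub>R z n))"
    by (rule norm_triangle_ineq4)
  also have "norm (smul im_unit (\<Sum>n\<in>T. re (im_unit * b n) *\<^sub>R z n))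
      \<le> norm (\<Sum>n\<in>T. re (im_unit * b n) *\<^sub>R z n)"
    using norm_im_unit_le by (simp add: norm_smul mult_left_le_one_le)
  finally show ?thesis using 1 2 by simp
qed

text \<open>
  The truncation at the greedy set of all coefficients of size at least \<open>t\<close> controls the signed
  indicator of that set. Every subset of it is again a greedy set of this indicator, so
  convexity removes the signs.
\<close>

lemma truncation_quasi_greedy_large_coefficients:
  assumes "truncation_quasi_greedy_on smul (closed_span smul (range x)) x c"
  obtains K where "K > 0"
    "\<And>f S t. f \<in> closed_span smul (range x) \<Longrightarrow> finite S \<Longrightarrow> \<forall>n\<in>S. t \<le> norm (c n f) \<Longrightarrow>
      t * norm (\<Sum>n\<in>S. x n) \<le> K * norm f"
proof -
  let ?Y = "closed_span smul (range x)"
  obtain \<Lambda> where \<Lambda>: "\<And>f B. f \<in> ?Y \<Longrightarrow> greedy_set c f B \<Longrightarrow>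
      norm (Min ((\<lambda>n. norm (c n f)) ` B) *\<^sub>R (\<Sum>n\<in>B. smul (sgn (c n f)) (x n))) \<le> \<Lambda> * norm f"
    using assms unfolding truncation_quasi_greedy_on_def by metis
  define L where "L = max 1 \<Lambda>"
  have L: "L \<ge> 1" by (simp add: L_def)
  have trunc: "norm (Min ((\<lambda>n. norm (c n f)) ` B) *\<^sub>R (\<Sum>n\<in>B. smul (sgn (c n f)) (x n)))
      \<le> L * norm f" if "f \<in> ?Y" "greedy_set c f B" for f B
    by (rule order_trans[OF \<Lambda>[OF that]]) (simp add: L_def mult_right_mono)
  have "t * norm (\<Sum>n\<in>S. x n) \<le> 4 * L\<^sup>2 * norm f"
    if f: "f \<in> ?Y" and S: "finite S" "\<forall>n\<in>S. t \<le> norm (c n f)" for f S t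
  proof (cases "t > 0 \<and> S \<noteq> {}")
    case False
    then have "t * norm (\<Sum>n\<in>S. x n) \<le> 0"
      by (auto simp: mult_nonpos_nonneg)
    also have "0 \<le> 4 * L\<^sup>2 * norm f" by simp
    finally show ?thesis .
  next
    case True
    then have t: "t > 0" "S \<noteq> {}" by auto
    define T where "T = {n. t \<le> norm (c n f)}"
    have T: "finite T" "S \<subseteq> T" "T \<noteq> {}"
      using finite_large_coefficients[OF f t(1)] S t by (auto simp: T_def)
    have sgn1: "norm (sgn (c n f)) = 1" "c n f \<noteq> 0" if "n \<in> T" for n
      using that t by (auto simp: T_def norm_sgn)
    have sgn_sgn: "sgn (sgn (c n f)) = sgn (c n f)" if "n \<in> T" for n
      using sgn1(1)[OF that] by (simp add: sgn_div_norm[of "sgn (c n f)"])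
    define z where "z n = smul (sgn (c n f)) (x n)" for n
    define F where "F = (\<Sum>n\<in>T. z n)"
    have tF: "t * norm F \<le> L * norm f"
    proof -
      have "greedy_set c f T"
        using T(1) by (auto simp: greedy_set_def T_def)
      from trunc[OF f this]
      have "\<bar>Min ((\<lambda>n. norm (c n f)) ` T)\<bar> * norm F \<le> L * norm f"
        by (simp add: F_def z_def)
      moreover have "t \<le> Min ((\<lambda>n. norm (c n f)) ` T)"
        using T by (subst Min_ge_iff) (auto simp: T_def)
      then have "t * norm F \<le> \<bar>Min ((\<lambda>n. norm (c n f)) ` T)\<bar> * norm F"
        by (intro mult_right_mono) auto
      ultimately show ?thesis by linarith
    qed
    have FY: "F \<in> ?Y"
      unfolding F_def z_def by (rule sum_smul_in_closed_span)
    have cF: "c n F = (if n \<in> T then sgn (c n f) else 0)" for n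
      unfolding F_def z_def by (rule c_sum_smul[OF T(1)])
    have sub: "norm (\<Sum>n\<in>B. z n) \<le> L * norm F" if B: "B \<subseteq> T" for B
    proof (cases "B = {}")
      case True
      then show ?thesis using L by simp
    next
      case False
      \<comment> \<open>The coefficients of \<open>F\<close> have modulus one on \<open>T\<close>
        and vanish off it, so truncation returns the plain partial sum over
        \<open>B\<close>.\<close>
      have "greedy_set c F B"
        using B T(1) finite_subset sgn1 by (auto simp: greedy_set_def cF)
      from trunc[OF FY this] have
        "norm (Min ((\<lambda>n. norm (c n F)) ` B) *\<^sub>R (\<Sum>n\<in>B. smul (sgn (c n F)) (x n))) \<le> L * norm F" .
      moreover have "(\<lambda>n. norm (c n F)) ` B = {1}"
        using False B sgn1 by (auto simp: cF subset_iff image_iff)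
      moreover have "(\<Sum>n\<in>B. smul (sgn (c n F)) (x n)) = (\<Sum>n\<in>B. z n)"
        using B sgn1 by (intro sum.cong) (auto simp: cF z_def sgn_sgn)
      ultimately show ?thesis by simp
    qed
    have "(\<Sum>n\<in>S. x n) = (\<Sum>n\<in>S. smul (inverse (sgn (c n f))) (z n))"
      using T(2) sgn1 by (intro sum.cong) (auto simp: z_def sgn_zero_iff subset_iff)
    also have "norm \<dots> \<le> 4 * (L * norm F)"
      using sub T(2) sgn1 by (intro norm_multiplier_le S) (auto simp: norm_inverse subset_iff)
    finally have "t * norm (\<Sum>n\<in>S. x n) \<le> t * (4 * (L * norm F))"
      using t by (intro mult_left_mono) auto
    also have "\<dots> = 4 * L * (t * norm F)" by simp
    also have "\<dots> \<le> 4 * L * (L * norm f)"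
      using tF L by (intro mult_left_mono) auto
    finally show ?thesis by (simp add: power2_eq_square mult_ac)
  qed
  moreover have "4 * L\<^sup>2 > 0" using L by simp
  ultimately show thesis using that by blast
qed

text \<open>
  The real functional obtained by dominated extension vanishes on the common kernel of
  \<open>c 0, \<dots>, c (N - 1)\<close>, hence it is the real part of a combination of these coefficients.
\<close>

lemma ex_norming_coefficients:
  assumes r: "0 \<le> r" "\<And>w. \<forall>n<N. c n w = 0 \<Longrightarrow> r \<le> norm (f + w)"
    and f: "f = (\<Sum>n<N. smul (c n f) (x n))"
  shows "\<exists>\<kappa>. r \<le> norm (\<Sum>n<N. \<kappa> n * c n f) \<and> (\<forall>v. norm (\<Sum>n<N. \<kappa> n * c n v) \<le> norm v)"
proof -
  define W where "W = {w. \<forall>n<N. c n w = 0}"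
  \<comment> \<open>The graph takes the value \<open>r\<close> at \<open>f\<close> and
    \<open>0\<close> on the common kernel \<open>W\<close>; it is dominated by the norm because
    \<open>f\<close> has distance at least \<open>r\<close> from \<open>W\<close>.\<close>
  define G where "G = {(a *\<^sub>R f + w, a * r) | a w. w \<in> W}"
  have W: "real_vector.subspace W"
    by (auto simp: W_def real_vector.subspace_def c_zero c_add c_scaleR)
  have G_le: "l \<le> norm v" if "(v, l) \<in> G" for v l
  proof -
    obtain a w where vl: "v = a *\<^sub>R f + w" "l = a * r" "w \<in> W"
      using \<open>(v, l) \<in> G\<close> by (auto simp: G_def)
    show ?thesis
    proof (cases "a > 0")
      case True
      have "inverse a *\<^sub>R w \<in> W" using real_vector.subspace_scale[OF W vl(3)] .
      then have "a * r \<le> a * norm (f + inverse a *\<^sub>R w)"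
        using r(2) True by (intro mult_left_mono) (auto simp: W_def)
      also have "\<dots> = norm (a *\<^sub>R (f + inverse a *\<^sub>R w))" using True by simp
      also have "a *\<^sub>R (f + inverse a *\<^sub>R w) = v"
        using True vl by (simp add: scaleR_add_right)
      finally show ?thesis using vl by simp
    next
      case False
      then have "l \<le> 0" using vl r(1) by (simp add: mult_nonpos_nonneg)
      also have "0 \<le> norm v" by simp
      finally show ?thesis .
    qed
  qed
  have G_sum: "G = {y + z | y z. y \<in> range (\<lambda>a. a *\<^sub>R (f, r)) \<and> z \<in> (\<lambda>w. (w, 0)) ` W}"
    by (force simp: G_def)
  have "real_vector.subspace (range (\<lambda>a. a *\<^sub>R (f, r)))"
    using real_vector.subspace_span[of "{(f, r)}"] by (simp add: real_vector.span_singleton)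
  moreover have "real_vector.subspace ((\<lambda>w. (w, 0::real)) ` W)"
    using W by (auto simp: real_vector.subspace_def zero_prod_def image_iff)
  ultimately have G: "real_vector.subspace G"
    unfolding G_sum by (rule real_vector.subspace_sums)
  \<comment> \<open>A complex line has the two real directions \<open>x n\<close> and
    \<open>im_unit\<close> times \<open>x n\<close>, hence the sum type as index.\<close>
  define s where "s i = (case i of Inl n \<Rightarrow> x n | Inr n \<Rightarrow> smul im_unit (x n))" for i :: "nat + nat"
  obtain d where "\<forall>v l t. (v, l) \<in> G \<longrightarrow> l + (\<Sum>i\<in>{..<N} <+> {..<N}. t i * d i)
      \<le> norm (v + (\<Sum>i\<in>{..<N} <+> {..<N}. t i *\<^sub>R s i))"
    using dominated_extension[OF _ G G_le, of "{..<N} <+> {..<N}" s] by auto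
  then have d: "l + (\<Sum>i\<in>{..<N} <+> {..<N}. t i * d i)
      \<le> norm (v + (\<Sum>i\<in>{..<N} <+> {..<N}. t i *\<^sub>R s i))" if "(v, l) \<in> G" for v l t
    using that by blast
  \<comment> \<open>A complex functional with real part h takes the value h(v) - i h(i v) at v. Here
    v is \<open>x n\<close>, and the two values of h are \<open>d (Inl n)\<close> and
    \<open>d (Inr n)\<close>.\<close>
  define \<kappa> where "\<kappa> n = of_real (d (Inl n)) - of_real (d (Inr n)) * im_unit" for n
  define g where "g v = (\<Sum>n<N. \<kappa> n * c n v)" for v
  define t where "t v i = (case i of Inl n \<Rightarrow> re (c n v) | Inr n \<Rightarrow> - re (im_unit * c n v))"
    for v and i :: "nat + nat"
  have t_s: "(\<Sum>i\<in>{..<N} <+> {..<N}. t v i *\<^sub>R s i) = (\<Sum>n<N. smul (c n v) (x n))" for v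
  proof -
    have "smul (c n v) (x n) = t v (Inl n) *\<^sub>R s (Inl n) + t v (Inr n) *\<^sub>R s (Inr n)" for n
    proof -
      have "smul im_unit (r' *\<^sub>R x n) = r' *\<^sub>R smul im_unit (x n)" for r'
        by (simp add: mult.commute flip: smul_of_real)
      then show ?thesis by (subst smul_decompose) (simp add: t_def s_def)
    qed
    then show ?thesis by (simp add: sum.Plus sum.distrib)
  qed
  have t_d: "(\<Sum>i\<in>{..<N} <+> {..<N}. t v i * d i) = re (g v)" for v
  proof -
    have "re (\<kappa> n * c n v) = t v (Inl n) * d (Inl n) + t v (Inr n) * d (Inr n)" for n
    proof -
      have "\<kappa> n * c n v = of_real (d (Inl n)) * c n v + of_real (- d (Inr n)) * (im_unit * c n v)"
        by (simp add: \<kappa>_def algebra_simps)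
      then show ?thesis by (simp only: re_add re_of_real_mult t_def) simp
    qed
    then show ?thesis by (simp add: sum.Plus sum.distrib g_def re_sum)
  qed
  have re_g: "a * r + re (g v) \<le> norm (a *\<^sub>R f + v)" for a v
  proof -
    \<comment> \<open>Subtracting the first \<open>N\<close> coefficient terms leaves a vector of
      \<open>W\<close>, so \<open>d\<close> applies to every \<open>v\<close>.\<close>
    define w where "w = v - (\<Sum>n<N. smul (c n v) (x n))"
    have "w \<in> W" by (simp add: W_def w_def c_diff c_sum_smul)
    then have "(a *\<^sub>R f + w, a * r) \<in> G" by (auto simp: G_def)
    from d[OF this, of "t v"] show ?thesis by (simp add: t_s t_d w_def add.assoc)
  qed
  have g_smul: "g (smul a v) = a * g v" for a v
    by (simp add: g_def c_smul sum_distrib_left mult_ac)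
  have "norm (g v) \<le> norm v" for v
  proof (cases "g v = 0")
    case False
    \<comment> \<open>A unimodular factor rotates \<open>g v\<close> onto the positive real axis,
      turning the bound on the real part into one on the modulus.\<close>
    let ?a = "of_real (norm (g v)) / g v"
    have "g (smul ?a v) = of_real (norm (g v))" using False by (simp add: g_smul)
    then have "norm (g v) = re (g (smul ?a v))" by (simp add: re_of_real)
    also have "\<dots> \<le> norm (smul ?a v)" using re_g[of 0 "smul ?a v"] by simp
    also have "\<dots> = norm v" using False by (simp add: norm_smul norm_divide)
    finally show ?thesis .
  qed simp
  moreover have "r \<le> norm (g f)"
  proof -
    \<comment> \<open>At \<open>a = 1\<close> and \<open>v = - f\<close> the right side of
      \<open>re_g\<close> is zero.\<close>
    have "g (- f) = - g f" using g_smul[of "-1" f] by simp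
    then have "r \<le> re (g f)" using re_g[of 1 "- f"] by (simp add: re_minus)
    then show ?thesis using re_le_norm[of "g f"] by linarith
  qed
  ultimately show ?thesis unfolding g_def by blast
qed

text \<open>
  The closed span of the coefficient functionals need not be norming, but it norms indicators:
  a vector with the coefficients of \<open>\<Sum>n\<in>A. x n\<close> up to \<open>N\<close> has large coefficients on \<open>A\<close>.
\<close>

lemma ex_norming_coefficients_indicator:
  assumes K: "K > 0"
    "\<And>f S t. f \<in> closed_span smul (range x) \<Longrightarrow> finite S \<Longrightarrow> \<forall>n\<in>S. t \<le> norm (c n f) \<Longrightarrow>
      t * norm (\<Sum>n\<in>S. x n) \<le> K * norm f"
    and full: "closed_span smul (range x) = UNIV" and A: "finite A"
  shows "\<exists>N \<kappa>. norm (\<Sum>n\<in>A. x n) \<le> K * norm (\<Sum>n<N. \<kappa> n * c n (\<Sum>k\<in>A. x k))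
    \<and> (\<forall>v. norm (\<Sum>n<N. \<kappa> n * c n v) \<le> norm v)"
proof -
  obtain N where N: "A \<subseteq> {..<N}"
    using A finite_nat_bounded by blast
  define f where "f = (\<Sum>k\<in>A. x k)"
  have cf: "c n f = (if n \<in> A then 1 else 0)" for n
    unfolding f_def by (rule c_indicator[OF A])
  have "\<exists>\<kappa>. norm f / K \<le> norm (\<Sum>n<N. \<kappa> n * c n f)
      \<and> (\<forall>v. norm (\<Sum>n<N. \<kappa> n * c n v) \<le> norm v)"
  proof (rule ex_norming_coefficients)
    show "0 \<le> norm f / K" using K by simp
    show "norm f / K \<le> norm (f + w)" if "\<forall>n<N. c n w = 0" for w
    proof -
      have "\<forall>n\<in>A. 1 \<le> norm (c n (f + w))"
        using that N by (auto simp: c_add cf)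
      then have "1 * norm f \<le> K * norm (f + w)"
        unfolding f_def using full by (intro K(2) A) auto
      then show ?thesis using K(1) by (simp add: divide_le_eq mult.commute)
    qed
    have "(\<Sum>n<N. smul (c n f) (x n)) = (\<Sum>n\<in>{..<N} \<inter> A. x n)"
      by (simp add: cf sum.inter_restrict if_distrib[of "\<lambda>a. smul a _"] cong: if_cong)
    also have "{..<N} \<inter> A = A" using N by auto
    finally show "f = (\<Sum>n<N. smul (c n f) (x n))" by (simp add: f_def)
  qed
  then show ?thesis using K(1) unfolding f_def by (simp add: divide_le_eq mult.commute) blast
qed

end

section \<open>Bidemocracy\<close>

text \<open>A functional may fail to attain its norm, hence the factor \<open>2\<close>. If no such
  \<open>f\<close> existed, the values on the unit ball would stay strictly below half the norm;
  this forces \<open>h = 0\<close>, which the strict inequality at \<open>0\<close>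
  excludes.\<close>

lemma ex_almost_norming_vector:
  fixes h :: "'a::real_normed_vector \<Rightarrow>\<^sub>L 'k::real_normed_field"
  shows "\<exists>f. norm f \<le> 1 \<and> norm h \<le> 2 * norm (blinfun_apply h f)"
proof (rule ccontr)
  assume *: "\<not> ?thesis"
  have small: "norm (blinfun_apply h f) < norm h / 2" if "norm f \<le> 1" for f
  proof -
    have "\<not> norm h \<le> 2 * norm (blinfun_apply h f)" using * that by blast
    then show ?thesis by simp
  qed
  have "norm h \<le> norm h / 2"
  proof (rule norm_blinfun_bound)
    fix v
    show "norm (blinfun_apply h v) \<le> norm h / 2 * norm v"
    proof (cases "v = 0")
      case False
      define u where "u = inverse (norm v) *\<^sub>R v"
      have "norm u \<le> 1" and v: "v = norm v *\<^sub>R u" using False by (simp_all add: u_def)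
      then have "norm (blinfun_apply h u) \<le> norm h / 2" by (intro order.strict_implies_order[OF small])
      then have "norm v * norm (blinfun_apply h u) \<le> norm v * (norm h / 2)"
        by (rule mult_left_mono) simp
      moreover have "norm (blinfun_apply h v) = norm v * norm (blinfun_apply h u)"
        by (subst v) (simp add: blinfun.scaleR_right)
      ultimately show ?thesis by (simp add: mult.commute)
    qed simp
  qed simp
  then have "h = 0" by simp
  with small[of 0] show False by simp
qed

text \<open>Truncation for \<open>x\<close> yields test coefficients for the dual basis; truncation
  for both sequences yields those for \<open>x\<close>. The product bound then applies.\<close>

theorem bidemocratic_of_truncation_quasi_greedy_dual:
  fixes smul :: "'k::real_normed_field \<Rightarrow> 'a::real_normed_vector \<Rightarrow> 'a" and re :: "'k \<Rightarrow> real"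
  assumes re: "real_part re im_unit" and smul: "normed_space_over smul"
    and basis: "is_basis smul x"
    and tqg: "truncation_quasi_greedy smul x" and pd: "partially_democratic x"
    and dtqg: "dual_truncation_quasi_greedy smul x"
    and dpd: "partially_democratic (dual_basis smul x)"
  shows "bidemocratic smul x"
proof -
  define xs where "xs = dual_basis smul x"
  have xs: "is_dual_sequence smul x xs"
    unfolding xs_def by (rule is_dual_sequence_dual_basis[OF smul basis])
  have bounded: "bounded (range x)" "bounded (range xs)"
    and full: "closed_span smul (range x) = UNIV"
    using basis xs by (auto simp: is_basis_def is_dual_sequence_def)
  have xs_smul: "blinfun_apply (xs n) (smul a f) = a * blinfun_apply (xs n) f" for n a f
    using xs by (auto simp: is_dual_sequence_def dual_space_def)
  have biorth: "blinfun_apply (xs n) (x k) = (if n = k then 1 else 0)" for n k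
    using xs by (auto simp: is_dual_sequence_def)
  obtain M where M: "\<And>n. norm (x n) \<le> M" using bounded(1) by (auto simp: bounded_iff)
  obtain M' where M': "\<And>n. norm (xs n) \<le> M'" using bounded(2) by (auto simp: bounded_iff)
  interpret X: coefficient_system smul re im_unit x "\<lambda>n. blinfun_apply (xs n)" M'
  proof (intro coefficient_system.intro smul re, unfold_locales)
    show "norm (blinfun_apply (xs n) f) \<le> M' * norm f" for n f
      by (rule order_trans[OF norm_blinfun]) (simp add: M' mult_right_mono)
  qed (simp_all add: blinfun.add_right xs_smul biorth)
  interpret D: coefficient_system dual_smul re im_unit xs "\<lambda>n f. blinfun_apply f (x n)" M
  proof (intro coefficient_system.intro normed_space_over_dual_smul re, unfold_locales)
    show "norm (blinfun_apply f (x n)) \<le> M * norm f" for n and f :: "'a \<Rightarrow>\<^sub>L 'k"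
      using order_trans[OF norm_blinfun mult_left_mono[OF M norm_ge_zero], of f n]
      by (simp add: mult.commute)
  qed (simp_all add: blinfun.add_left biorth)
  have tqg': "truncation_quasi_greedy_on smul (closed_span smul (range x)) x
      (\<lambda>n. blinfun_apply (xs n))"
    using tqg by (simp add: truncation_quasi_greedy_def full xs_def)
  have dtqg': "truncation_quasi_greedy_on dual_smul (closed_span dual_smul (range xs)) xs
      (\<lambda>n f. blinfun_apply f (x n))"
    using dtqg by (simp add: dual_truncation_quasi_greedy_def xs_def)
  obtain K where K: "K > 0" "\<And>f S t. f \<in> closed_span smul (range x) \<Longrightarrow> finite S \<Longrightarrow>
      \<forall>n\<in>S. t \<le> norm (blinfun_apply (xs n) f) \<Longrightarrow> t * norm (\<Sum>n\<in>S. x n) \<le> K * norm f"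
    using X.truncation_quasi_greedy_large_coefficients[OF tqg'] by blast
  obtain K' where K': "K' > 0" "\<And>f S t. f \<in> closed_span dual_smul (range xs) \<Longrightarrow> finite S \<Longrightarrow>
      \<forall>n\<in>S. t \<le> norm (blinfun_apply f (x n)) \<Longrightarrow> t * norm (\<Sum>n\<in>S. xs n) \<le> K' * norm f"
    using D.truncation_quasi_greedy_large_coefficients[OF dtqg'] by blast
  have scale_le: "L * norm f \<le> max L L'" if "0 < L" "norm f \<le> 1"
    for L L' :: real and f :: "'c::real_normed_vector"
    using that by (simp add: le_max_iff_disj mult_left_le)
  have test1: "has_test_coefficients TYPE('k) xs x (max K 2)"
    unfolding has_test_coefficients_def
  proof (intro allI impI)
    fix A :: "nat set"
    obtain f where f: "norm f \<le> 1"
      "norm (\<Sum>n\<in>A. xs n) \<le> 2 * norm (blinfun_apply (\<Sum>n\<in>A. xs n) f)"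
      using ex_almost_norming_vector by blast
    show "\<exists>a :: nat \<Rightarrow> 'k. norm (\<Sum>n\<in>A. xs n) \<le> max K 2 * norm (\<Sum>n\<in>A. a n) \<and>
      (\<forall>S. finite S \<longrightarrow> norm (\<Sum>n\<in>S. a n) \<le> norm (\<Sum>n\<in>S. xs n)) \<and>
      (\<forall>S t. finite S \<longrightarrow> (\<forall>n\<in>S. t \<le> norm (a n)) \<longrightarrow> t * norm (\<Sum>n\<in>S. x n) \<le> max K 2)"
    proof (intro exI[of _ "\<lambda>n. blinfun_apply (xs n) f"] conjI allI impI)
      show "norm (\<Sum>n\<in>A. xs n) \<le> max K 2 * norm (\<Sum>n\<in>A. blinfun_apply (xs n) f)"
        by (rule order_trans[OF f(2)]) (simp add: blinfun.sum_left mult_right_mono)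
      show "norm (\<Sum>n\<in>S. blinfun_apply (xs n) f) \<le> norm (\<Sum>n\<in>S. xs n)" for S
      proof -
        have "norm (blinfun_apply (\<Sum>n\<in>S. xs n) f) \<le> norm (\<Sum>n\<in>S. xs n) * norm f"
          by (rule norm_blinfun)
        also have "\<dots> \<le> norm (\<Sum>n\<in>S. xs n)" using f(1) by (simp add: mult_left_le)
        finally show ?thesis by (simp add: blinfun.sum_left)
      qed
      show "t * norm (\<Sum>n\<in>S. x n) \<le> max K 2"
        if "finite S" "\<forall>n\<in>S. t \<le> norm (blinfun_apply (xs n) f)" for S t
        by (rule order_trans[OF K(2)[OF _ that] scale_le[OF K(1) f(1)]]) (simp add: full)
    qed
  qed
  have test2: "has_test_coefficients TYPE('k) x xs (max K' K)"
    unfolding has_test_coefficients_def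
  proof (intro allI impI)
    fix A :: "nat set"
    assume A: "finite A"
    \<comment> \<open>A norming functional from the whole dual space could lie outside the closed
      span of \<open>xs\<close>, where dual truncation says nothing; a finite combination stays
      inside.\<close>
    obtain N \<kappa> where \<kappa>: "norm (\<Sum>n\<in>A. x n)
        \<le> K * norm (\<Sum>n<N. \<kappa> n * blinfun_apply (xs n) (\<Sum>k\<in>A. x k))"
      "\<And>v. norm (\<Sum>n<N. \<kappa> n * blinfun_apply (xs n) v) \<le> norm v"
      using X.ex_norming_coefficients_indicator[OF K full A] by blast
    define g where "g = (\<Sum>n<N. dual_smul (\<kappa> n) (xs n))"
    have g: "blinfun_apply g v = (\<Sum>n<N. \<kappa> n * blinfun_apply (xs n) v)" for v
      by (simp add: g_def blinfun.sum_left)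
    have g_norm: "norm g \<le> 1"
      using \<kappa>(2) by (intro norm_blinfun_bound) (auto simp: g)
    have g_span: "g \<in> closed_span dual_smul (range xs)"
      unfolding g_def by (rule D.sum_smul_in_closed_span)
    show "\<exists>a :: nat \<Rightarrow> 'k. norm (\<Sum>n\<in>A. x n) \<le> max K' K * norm (\<Sum>n\<in>A. a n) \<and>
      (\<forall>S. finite S \<longrightarrow> norm (\<Sum>n\<in>S. a n) \<le> norm (\<Sum>n\<in>S. x n)) \<and>
      (\<forall>S t. finite S \<longrightarrow> (\<forall>n\<in>S. t \<le> norm (a n)) \<longrightarrow> t * norm (\<Sum>n\<in>S. xs n) \<le> max K' K)"
    proof (intro exI[of _ "\<lambda>n. blinfun_apply g (x n)"] conjI allI impI)
      have "norm (\<Sum>n\<in>A. x n) \<le> K * norm (blinfun_apply g (\<Sum>k\<in>A. x k))"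
        using \<kappa>(1) by (simp only: g)
      also have "\<dots> \<le> max K' K * norm (\<Sum>n\<in>A. blinfun_apply g (x n))"
        by (simp add: blinfun.sum_right mult_right_mono)
      finally show "norm (\<Sum>n\<in>A. x n) \<le> max K' K * norm (\<Sum>n\<in>A. blinfun_apply g (x n))" .
      show "norm (\<Sum>n\<in>S. blinfun_apply g (x n)) \<le> norm (\<Sum>n\<in>S. x n)" for S
        using \<kappa>(2)[of "\<Sum>n\<in>S. x n"] unfolding g[symmetric] by (simp add: blinfun.sum_right)
      show "t * norm (\<Sum>n\<in>S. xs n) \<le> max K' K"
        if "finite S" "\<forall>n\<in>S. t \<le> norm (blinfun_apply g (x n))" for S t
        by (rule order_trans[OF K'(2)[OF g_span that] scale_le[OF K'(1) g_norm]])
    qed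
  qed
  have "partially_democratic xs" using dpd by (simp add: xs_def)
  from upper_fundamental_product_bound[OF bounded pd this test2 test1]
  show ?thesis unfolding bidemocratic_def xs_def .
qed

theorem theorem2p4:
  "(\<forall>x :: nat \<Rightarrow> 'a::banach.
      is_basis scaleR x \<and>
      truncation_quasi_greedy scaleR x \<and> partially_democratic x \<and>
      dual_truncation_quasi_greedy scaleR x \<and> partially_democratic (dual_basis scaleR x)
      \<longrightarrow> bidemocratic scaleR x)
   \<and>
   (\<forall>(smul :: complex \<Rightarrow> 'b::banach \<Rightarrow> 'b) (x :: nat \<Rightarrow> 'b).
      normed_space_over smul \<and> is_basis smul x \<and>
      truncation_quasi_greedy smul x \<and> partially_democratic x \<and>
      dual_truncation_quasi_greedy smul x \<and> partially_democratic (dual_basis smul x)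
      \<longrightarrow> bidemocratic smul x)"
  using bidemocratic_of_truncation_quasi_greedy_dual[OF real_part_real normed_space_over_scaleR]
    bidemocratic_of_truncation_quasi_greedy_dual[OF real_part_complex]
  by blast

end
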